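(* The classical Smoluchowski-Kramers approximation does not hold in general for variable friction. That is, there exist a dimension $d\ge 1$, a vector field $\boldsymbol b:\mathbb R^d\to\mathbb R^d$ and a function $\lambda:\mathbb R^d\to\mathbb R$, both continuously differentiable and bounded together with their first derivatives, with $0<\lambda_0\le\lambda(\cdot)\le\Lambda<\infty$ for some constants $\lambda_0,\Lambda$, initial data $\boldsymbol q,\boldsymbol p\in\mathbb R^d$, and constants $\kappa,T>0$ such that $$\mathbf P\Big(\max_{0\le t\le T}|\boldsymbol q_t^\mu-\boldsymbol q_t|_{\mathbb R^d}>\kappa\Big)\ \text{ does not converge to } 0 \text{ as } \mu\downarrow 0,$$ where, for a standard Wiener process $\boldsymbol W_t$ in $\mathbb R^d$, $\boldsymbol q_t^\mu$ is the solution of $$\mu\ddot{\boldsymbol q}_t^\mu=\boldsymbol b(\boldsymbol q_t^\mu)-\lambda(\boldsymbol q_t^\mu)\dot{\boldsymbol q}_t^\mu+\dot{\boldsymbol W}_t,\qquad \boldsymbol q_0^\mu=\boldsymbol q,\ \dot{\boldsymbol q}_0^\mu=\boldsymbol p,$$ and $\boldsymbol q_t$ is the solution, driven by the same Wiener process, of $$\dot{\boldsymbol q}_t=\frac{\boldsymbol b(\boldsymbol q_t)}{\lambda(\boldsymbol q_t)}+\frac{1}{\lambda(\boldsymbol q_t)}\dot{\boldsymbol W}_t,\qquad \boldsymbol q_0=\boldsymbol q,$$ with the stochastic term understood in the It\^o sense.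
   Context: The second order equation is understood as the first order system $\dot{\boldsymbol q}_t^\mu=\boldsymbol p_t^\mu$, $\dot{\boldsymbol p}_t^\mu=\frac1\mu\boldsymbol b(\boldsymbol q_t^\mu)-\frac{\lambda(\boldsymbol q_t^\mu)}{\mu}\boldsymbol p_t^\mu+\frac1\mu\dot{\boldsymbol W}_t$ with $\boldsymbol p_0^\mu=\boldsymbol p$; here $\mu>0$ is the mass, and $|\cdot|_{\mathbb R^d}$ is the Euclidean norm. *)

theory Defs
  imports "HOL-Probability.Probability" "HOL-Analysis.Abstract_Euclidean_Space"
begin

text \<open>
  Since the dimension is existentially quantified, \<open>\<real>\<^sup>d\<close> is the set
  \<open>topspace (Euclidean_space d)\<close> of sequences vanishing from index \<open>d\<close> on, and its norm is
  \<open>\<lambda>x. L2_set x {..<d}\<close>.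
\<close>

definition C1_bounded :: "nat \<Rightarrow> ((nat \<Rightarrow> real) \<Rightarrow> real) \<Rightarrow> bool" where
  "C1_bounded d f \<longleftrightarrow>
     continuous_map (Euclidean_space d) euclideanreal f \<and>
     bounded (f ` topspace (Euclidean_space d)) \<and>
     (\<exists>f'. \<forall>i<d.
        (\<forall>x\<in>topspace (Euclidean_space d).
           ((\<lambda>s. f (x(i := s))) has_real_derivative f' i x) (at (x i))) \<and>
        continuous_map (Euclidean_space d) euclideanreal (f' i) \<and>
        bounded (f' i ` topspace (Euclidean_space d)))"

definition C1_bounded_field :: "nat \<Rightarrow> ((nat \<Rightarrow> real) \<Rightarrow> nat \<Rightarrow> real) \<Rightarrow> bool" where
  "C1_bounded_field d b \<longleftrightarrow>
     b \<in> topspace (Euclidean_space d) \<rightarrow> topspace (Euclidean_space d) \<and>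
     (\<forall>i<d. C1_bounded d (\<lambda>x. b x i))"

text \<open>
  Time is \<open>[0,\<infinity>)\<close>, represented in \<open>real\<close>. A filtration indexed by \<open>[0,\<infinity>)\<close> extends to \<open>real\<close> by
  \<open>F t = F 0\<close> for \<open>t < 0\<close>, so indexing by all reals is no restriction.
\<close>

definition filtered_prob_space :: "'w measure \<Rightarrow> (real \<Rightarrow> 'w measure) \<Rightarrow> bool" where
  "filtered_prob_space M F \<longleftrightarrow>
     prob_space M \<and> filtration (space M) F \<and> (\<forall>t. subalgebra M (F t))"

definition continuous_adapted ::
  "'w measure \<Rightarrow> (real \<Rightarrow> 'w measure) \<Rightarrow> nat \<Rightarrow> (real \<Rightarrow> 'w \<Rightarrow> nat \<Rightarrow> real) \<Rightarrow> bool" where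
  "continuous_adapted M F d X \<longleftrightarrow>
     (\<forall>t\<ge>0. \<forall>\<omega>\<in>space M. X t \<omega> \<in> topspace (Euclidean_space d)) \<and>
     (\<forall>t\<ge>0. \<forall>i<d. (\<lambda>\<omega>. X t \<omega> i) \<in> borel_measurable (F t)) \<and>
     (\<forall>\<omega>\<in>space M. \<forall>i<d. continuous_on {0..} (\<lambda>t. X t \<omega> i))"

text \<open>
  Standard \<open>d\<close>-dimensional Wiener process relative to \<open>F\<close>: the increments over \<open>[s,t]\<close> are
  independent of \<open>F s\<close> and have the law \<open>N(0, (t - s) I\<^sub>d)\<close>, written as a product measure
  (\<open>normal_density\<close> takes the standard deviation).
\<close>

definition wiener_process ::
  "'w measure \<Rightarrow> (real \<Rightarrow> 'w measure) \<Rightarrow> nat \<Rightarrow> (real \<Rightarrow> 'w \<Rightarrow> nat \<Rightarrow> real) \<Rightarrow> bool" where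
  "wiener_process M F d W \<longleftrightarrow>
     continuous_adapted M F d W \<and>
     (AE \<omega> in M. \<forall>i<d. W 0 \<omega> i = 0) \<and>
     (\<forall>s t. 0 \<le> s \<and> s < t \<longrightarrow>
        (let \<Delta> = (\<lambda>\<omega>. \<lambda>i\<in>{..<d}. W t \<omega> i - W s \<omega> i); N = (\<Pi>\<^sub>M i\<in>{..<d}. (borel :: real measure))
         in prob_space.indep_set M (sets (F s)) (sets (vimage_algebra (space M) \<Delta> N)) \<and>
            distr M N \<Delta> =
              (\<Pi>\<^sub>M i\<in>{..<d}. density lborel (\<lambda>x. ennreal (normal_density 0 (sqrt (t - s)) x)))))"

text \<open>
  The It\^o integral over \<open>[0,t]\<close> against a scalar Wiener process \<open>B\<close>, as the \<open>L\<^sup>2\<close> limit of the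
  integrals of simple processes. A simple process is given by grid points
  \<open>u 0 \<le> \<dots> \<le> u n\<close> in \<open>[0,t]\<close> and bounded \<open>F (u j)\<close>-measurable heights \<open>h j\<close> on \<open>(u j, u (j + 1)]\<close>.
  The integral is determined up to null sets, hence a relation.
\<close>

definition is_simple_process ::
  "(real \<Rightarrow> 'w measure) \<Rightarrow> real \<Rightarrow> nat \<Rightarrow> (nat \<Rightarrow> real) \<Rightarrow> (nat \<Rightarrow> 'w \<Rightarrow> real) \<Rightarrow> bool" where
  "is_simple_process F t n u h \<longleftrightarrow>
     0 \<le> u 0 \<and> u n \<le> t \<and> (\<forall>j<n. u j \<le> u (Suc j)) \<and>
     (\<forall>j<n. h j \<in> borel_measurable (F (u j)) \<and> bounded (h j ` space (F (u j))))"

definition simple_process ::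
  "nat \<Rightarrow> (nat \<Rightarrow> real) \<Rightarrow> (nat \<Rightarrow> 'w \<Rightarrow> real) \<Rightarrow> real \<Rightarrow> 'w \<Rightarrow> real" where
  "simple_process n u h s \<omega> = (\<Sum>j<n. h j \<omega> * indicator {u j<..u (Suc j)} s)"

definition simple_integral_process ::
  "(real \<Rightarrow> 'w \<Rightarrow> real) \<Rightarrow> nat \<Rightarrow> (nat \<Rightarrow> real) \<Rightarrow> (nat \<Rightarrow> 'w \<Rightarrow> real) \<Rightarrow> 'w \<Rightarrow> real" where
  "simple_integral_process B n u h \<omega> = (\<Sum>j<n. h j \<omega> * (B (u (Suc j)) \<omega> - B (u j) \<omega>))"

definition ito_integrand ::
  "'w measure \<Rightarrow> (real \<Rightarrow> 'w measure) \<Rightarrow> real \<Rightarrow> (real \<Rightarrow> 'w \<Rightarrow> real) \<Rightarrow> bool" where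
  "ito_integrand M F t H \<longleftrightarrow>
     (\<lambda>(s, \<omega>). H s \<omega>) \<in> borel_measurable (restrict_space borel {0..t} \<Otimes>\<^sub>M M) \<and>
     (\<forall>s\<in>{0..t}. H s \<in> borel_measurable (F s)) \<and>
     (\<integral>\<^sup>+\<omega>. (\<integral>\<^sup>+s\<in>{0..t}. ennreal ((H s \<omega>)\<^sup>2) \<partial>lborel) \<partial>M) < \<infinity>"

definition has_ito_integral ::
  "'w measure \<Rightarrow> (real \<Rightarrow> 'w measure) \<Rightarrow> (real \<Rightarrow> 'w \<Rightarrow> real) \<Rightarrow> real \<Rightarrow>
     (real \<Rightarrow> 'w \<Rightarrow> real) \<Rightarrow> ('w \<Rightarrow> real) \<Rightarrow> bool" where
  "has_ito_integral M F B t H I \<longleftrightarrow>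
     ito_integrand M F t H \<and> I \<in> borel_measurable M \<and>
     (\<exists>n u h.
        (\<forall>k. is_simple_process F t (n k) (u k) (h k)) \<and>
        (\<lambda>k. \<integral>\<^sup>+\<omega>. (\<integral>\<^sup>+s\<in>{0..t}.
            ennreal ((H s \<omega> - simple_process (n k) (u k) (h k) s \<omega>)\<^sup>2) \<partial>lborel) \<partial>M)
          \<longlonglongrightarrow> 0 \<and>
        (\<lambda>k. \<integral>\<^sup>+\<omega>. ennreal ((I \<omega> - simple_integral_process B (n k) (u k) (h k) \<omega>)\<^sup>2) \<partial>M)
          \<longlonglongrightarrow> 0)"

text \<open>
  \<open>dQ = a(Q) dt + \<sigma>(Q) dW\<close> (It\^o) with scalar \<open>\<sigma>\<close>. As \<open>Q\<close> is continuous, asking for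
  the integral equation almost surely at each fixed time is the same as asking for it almost
  surely at all times, for the continuous version of the stochastic integral.
\<close>

definition ito_sde_solution ::
  "'w measure \<Rightarrow> (real \<Rightarrow> 'w measure) \<Rightarrow> nat \<Rightarrow> (real \<Rightarrow> 'w \<Rightarrow> nat \<Rightarrow> real) \<Rightarrow>
     ((nat \<Rightarrow> real) \<Rightarrow> nat \<Rightarrow> real) \<Rightarrow> ((nat \<Rightarrow> real) \<Rightarrow> real) \<Rightarrow> (nat \<Rightarrow> real) \<Rightarrow>
     (real \<Rightarrow> 'w \<Rightarrow> nat \<Rightarrow> real) \<Rightarrow> bool" where
  "ito_sde_solution M F d W a \<sigma> q Q \<longleftrightarrow>
     continuous_adapted M F d Q \<and>
     (AE \<omega> in M. Q 0 \<omega> = q) \<and>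
     (\<forall>t\<ge>0. \<forall>i<d. has_ito_integral M F (\<lambda>s \<omega>. W s \<omega> i) t (\<lambda>s \<omega>. \<sigma> (Q s \<omega>))
        (\<lambda>\<omega>. Q t \<omega> i - q i - integral {0..t} (\<lambda>s. a (Q s \<omega>) i)))"

text \<open>The first-order system for position \<open>Q\<close> and velocity \<open>P\<close> of a particle of mass \<open>\<mu>\<close>.\<close>

definition langevin_solution ::
  "'w measure \<Rightarrow> (real \<Rightarrow> 'w measure) \<Rightarrow> nat \<Rightarrow> (real \<Rightarrow> 'w \<Rightarrow> nat \<Rightarrow> real) \<Rightarrow>
     ((nat \<Rightarrow> real) \<Rightarrow> nat \<Rightarrow> real) \<Rightarrow> ((nat \<Rightarrow> real) \<Rightarrow> real) \<Rightarrow> real \<Rightarrow>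
     (nat \<Rightarrow> real) \<Rightarrow> (nat \<Rightarrow> real) \<Rightarrow>
     (real \<Rightarrow> 'w \<Rightarrow> nat \<Rightarrow> real) \<Rightarrow> (real \<Rightarrow> 'w \<Rightarrow> nat \<Rightarrow> real) \<Rightarrow> bool" where
  "langevin_solution M F d W b lam \<mu> q p Q P \<longleftrightarrow>
     continuous_adapted M F d Q \<and> continuous_adapted M F d P \<and>
     (AE \<omega> in M. \<forall>t\<ge>0. \<forall>i<d.
        Q t \<omega> i = q i + integral {0..t} (\<lambda>s. P s \<omega> i) \<and>
        P t \<omega> i = p i
          + integral {0..t} (\<lambda>s. b (Q s \<omega>) i / \<mu> - lam (Q s \<omega>) / \<mu> * P s \<omega> i)
          + W t \<omega> i / \<mu>)"

end

theory Submission
  imports Defs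
begin

text \<open>
  Take \<open>d = 1\<close>, \<open>b = 0\<close> and zero initial data, and let \<open>V\<close> be a primitive of the friction.
  The Langevin system integrates to \<open>V (q\<^sup>\<mu>\<^sub>t) - V 0 = W\<^sub>t - \<mu> p\<^sup>\<mu>\<^sub>t\<close>, and
  \<open>\<mu> p\<^sup>\<mu>\<^sub>t \<rightarrow> 0\<close> path by path because the friction damps the momentum exponentially fast.
  If \<open>q\<^sup>\<mu>\<close> stayed within \<open>\<kappa>\<close> of the It\^o solution \<open>q\<close>, then \<open>V (q\<^sub>T) - V 0\<close> would be within \<open>3\<kappa>\<close>
  of \<open>W\<^sub>T\<close> almost surely, as \<open>V\<close> is 3-Lipschitz. But \<open>q\<^sub>T\<close> and \<open>W\<^sub>T\<close> both have mean zero, while for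
  the decreasing friction \<open>2 - x / sqrt (1 + x\<^sup>2)\<close> the primitive is strictly concave, so
  \<open>V (q\<^sub>T) - V 0\<close> has mean below \<open>- 3\<kappa>\<close> once \<open>E \<bar>W\<^sub>T\<bar>\<close> is large.
\<close>

section \<open>Damping of the momentum\<close>

text \<open>The rate \<open>l\<close> multiplies damping and forcing alike, so a forcing with
  \<open>w \<ge> - k\<close> can hold \<open>Z\<close> up at level \<open>k\<close> at most, however
  large \<open>l\<close> is. Hence the term \<open>k\<close> survives unchanged when the rate, a
  friction divided by the mass, blows up.\<close>

lemma relaxation_upper:
  fixes Z :: "real \<Rightarrow> real"
  assumes "a \<le> b"
    and l: "continuous_on {a..b} l" "\<And>t. t \<in> {a..b} \<Longrightarrow> l0 \<le> l t" "0 \<le> l0"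
    and w: "\<And>t. t \<in> {a..b} \<Longrightarrow> - k \<le> w t" and "0 \<le> k"
    and Z: "\<And>t. t \<in> {a..b} \<Longrightarrow> (Z has_real_derivative - (l t * (Z t + w t))) (at t within {a..b})"
  shows "Z b \<le> exp (- (l0 * (b - a))) * \<bar>Z a\<bar> + k"
proof -
  define L where "L x = integral {a..x} l" for x
  \<comment> \<open>Subtracting \<open>k\<close> makes the forcing term nonpositive, so the integrating factor gives monotonicity.\<close>
  define V where "V x = exp (L x) * (Z x - k)" for x
  have V': "(V has_real_derivative - (exp (L x) * l x * (w x + k))) (at x within {a..b})"
    if "x \<in> {a..b}" for x
    unfolding V_def L_def
    by (rule derivative_eq_intros integral_has_real_derivative[OF l(1) that] Z[OF that] refl)+
      (simp add: algebra_simps)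
  have "V b \<le> V a"
  proof (rule DERIV_nonpos_imp_decreasing_open[OF \<open>a \<le> b\<close>])
    fix x assume x: "a < x" "x < b"
    have "(V has_real_derivative - (exp (L x) * l x * (w x + k))) (at x)"
      using V'[of x] x by (simp add: at_within_Icc_at)
    moreover have "0 \<le> exp (L x) * l x * (w x + k)"
      using x l(2)[of x] w[of x] l(3) by (intro mult_nonneg_nonneg) auto
    ultimately show "\<exists>y. (V has_real_derivative y) (at x) \<and> y \<le> 0"
      by (intro exI[of _ "- (exp (L x) * l x * (w x + k))"]) simp
  next
    show "continuous_on {a..b} V"
      by (rule DERIV_continuous_on[OF V'])
  qed
  then have "exp (L b) * (Z b - k) \<le> \<bar>Z a\<bar>"
    using \<open>0 \<le> k\<close> by (simp add: V_def L_def)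
  then have "Z b - k \<le> exp (- L b) * \<bar>Z a\<bar>"
    by (simp add: exp_minus field_simps)
  also have "\<dots> \<le> exp (- (l0 * (b - a))) * \<bar>Z a\<bar>"
  proof -
    have "integral {a..b} (\<lambda>_. l0) \<le> L b"
      unfolding L_def using l by (intro integral_le integrable_continuous_real) auto
    then show ?thesis
      using \<open>a \<le> b\<close> by (intro mult_right_mono) (auto simp: mult.commute)
  qed
  finally show ?thesis
    by simp
qed

text \<open>The equation is invariant under changing the signs of \<open>Z\<close> and
  \<open>w\<close> together, so the one-sided bound applies to both signs.\<close>

lemma relaxation_bound:
  fixes Z :: "real \<Rightarrow> real"
  assumes "a \<le> b"
    and l: "continuous_on {a..b} l" "\<And>t. t \<in> {a..b} \<Longrightarrow> l0 \<le> l t" "0 \<le> l0"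
    and w: "\<And>t. t \<in> {a..b} \<Longrightarrow> \<bar>w t\<bar> \<le> k"
    and Z: "\<And>t. t \<in> {a..b} \<Longrightarrow> (Z has_real_derivative - (l t * (Z t + w t))) (at t within {a..b})"
  shows "\<bar>Z b\<bar> \<le> exp (- (l0 * (b - a))) * \<bar>Z a\<bar> + k"
proof -
  have k: "0 \<le> k"
    using w[of a] \<open>a \<le> b\<close> by auto
  have w': "- k \<le> w t" "- k \<le> - w t" if "t \<in> {a..b}" for t
    using w[OF that] by auto
  have "Z b \<le> exp (- (l0 * (b - a))) * \<bar>Z a\<bar> + k"
    by (rule relaxation_upper[OF \<open>a \<le> b\<close> l w'(1) k Z])
  moreover have "- Z b \<le> exp (- (l0 * (b - a))) * \<bar>- Z a\<bar> + k"
    by (rule relaxation_upper[OF \<open>a \<le> b\<close> l w'(2) k, where Z = "\<lambda>t. - Z t"])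
      (auto intro!: derivative_eq_intros Z simp: algebra_simps)
  ultimately show ?thesis
    by simp
qed

text \<open>Here \<open>X\<close> stands for mass times velocity. Its memory has length of order
  \<open>\<mu> n\<close>, and over so short a time before \<open>T\<close> the continuous path
  \<open>W\<close> hardly moves. The friction \<open>l n\<close> is evaluated along the n-th
  trajectory, so it varies with n and only a lower bound uniform in n is assumed.\<close>

lemma friction_kills_momentum:
  fixes W :: "real \<Rightarrow> real" and X l :: "nat \<Rightarrow> real \<Rightarrow> real" and \<mu> :: "nat \<Rightarrow> real"
  assumes "0 < T" "0 < l0"
    and W: "continuous_on {0..T} W"
    and \<mu>: "\<And>n. 0 < \<mu> n" "\<mu> \<longlonglongrightarrow> 0"
    and l: "\<And>n. continuous_on {0..T} (l n)" "\<And>n t. t \<in> {0..T} \<Longrightarrow> l0 \<le> l n t"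
    and X: "\<And>n. continuous_on {0..T} (X n)"
      "\<And>n t. t \<in> {0..T} \<Longrightarrow> X n t = W t - integral {0..t} (\<lambda>s. l n s / \<mu> n * X n s)"
  shows "(\<lambda>n. X n T) \<longlonglongrightarrow> 0"
proof -
  \<comment> \<open>\<open>X\<close> need not be differentiable, but subtracting the rough path leaves a \<open>C\<^sup>1\<close> function.\<close>
  define Z where "Z n t = X n t - (W t - W T)" for n t
  have Z': "(Z n has_real_derivative - (l n t / \<mu> n * (Z n t + (W t - W T)))) (at t within {0..T})"
    if "t \<in> {0..T}" for n t
  proof -
    have "continuous_on {0..T} (\<lambda>s. l n s / \<mu> n * X n s)"
      using \<mu>(1)[of n] by (intro continuous_intros l X) auto
    from integral_has_real_derivative[OF this that]
    have "((\<lambda>t. W T - integral {0..t} (\<lambda>s. l n s / \<mu> n * X n s)) has_real_derivative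
        - (l n t / \<mu> n * X n t)) (at t within {0..T})"
      using DERIV_diff[OF DERIV_const[of "W T"]] by (fastforce simp only: diff_0)
    moreover have "W T - integral {0..t} (\<lambda>s. l n s / \<mu> n * X n s) = Z n t" if "t \<in> {0..T}" for t
      using X(2)[OF that] by (simp add: Z_def)
    ultimately have "(Z n has_real_derivative - (l n t / \<mu> n * X n t)) (at t within {0..T})"
      using that by (subst (asm) has_field_derivative_cong_eventually) (auto simp: eventually_at_filter)
    then show ?thesis
      by (simp add: Z_def)
  qed
  have relax: "\<bar>Z n b\<bar> \<le> exp (- (l0 / \<mu> n * (b - a))) * \<bar>Z n a\<bar> + k"
    if "0 \<le> a" "a \<le> b" "b \<le> T" "\<And>t. t \<in> {a..b} \<Longrightarrow> \<bar>W t - W T\<bar> \<le> k" for n a b k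
  proof (rule relaxation_bound[OF that(2), where l = "\<lambda>t. l n t / \<mu> n" and w = "\<lambda>t. W t - W T"])
    show "continuous_on {a..b} (\<lambda>t. l n t / \<mu> n)"
      using \<mu>(1)[of n] that by (intro continuous_intros continuous_on_subset[OF l(1)]) auto
    show "(Z n has_real_derivative - (l n t / \<mu> n * (Z n t + (W t - W T)))) (at t within {a..b})"
      if "t \<in> {a..b}" for t
      using that \<open>0 \<le> a\<close> \<open>b \<le> T\<close> by (intro has_field_derivative_subset[OF Z']) auto
  qed (use \<mu>(1)[of n] l(2)[of _ n] that \<open>0 < l0\<close> in \<open>auto intro!: divide_right_mono simp: less_imp_le\<close>)
  have "bounded ((\<lambda>t. W t - W T) ` {0..T})"
    by (intro compact_imp_bounded compact_continuous_image continuous_intros W) auto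
  then obtain K where K: "\<And>t. t \<in> {0..T} \<Longrightarrow> \<bar>W t - W T\<bar> \<le> K"
    unfolding bounded_iff by (metis image_eqI real_norm_def)
  \<comment> \<open>\<open>Z\<close> is normalised to agree with \<open>X\<close> at
    \<open>T\<close>, not at 0. Its initial value is then the same for all n, which makes the crude
    bound uniform in n.\<close>
  have Z0: "Z n 0 = W T" for n
    using X(2)[of 0 n] \<open>0 < T\<close> by (simp add: Z_def)
  have ZT: "X n T = Z n T" for n
    by (simp add: Z_def)
  show ?thesis
  proof (rule LIMSEQ_I)
    fix e :: real assume "0 < e"
    then obtain d where "d > 0" and d: "\<And>t. t \<in> {0..T} \<Longrightarrow> dist t T < d \<Longrightarrow> dist (W t) (W T) < e / 2"
      using bspec[OF W[unfolded continuous_on_iff], of T, rule_format, of "e / 2"] \<open>0 < T\<close> by auto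
    \<comment> \<open>On \<open>[0, T - r]\<close> the crude bound suffices; the last stretch of length \<open>r\<close> damps it away.\<close>
    define r where "r = min (d / 2) T"
    have r: "0 < r" "r \<le> T" "r < d"
      using \<open>d > 0\<close> \<open>0 < T\<close> by (auto simp: r_def)
    have bound: "\<bar>X n T\<bar> \<le> exp (- (l0 / \<mu> n * r)) * (\<bar>W T\<bar> + K) + e / 2" for n
    proof -
      have "\<bar>Z n (T - r)\<bar> \<le> exp (- (l0 / \<mu> n * (T - r - 0))) * \<bar>Z n 0\<bar> + K"
        using r K by (intro relax) auto
      also have "\<dots> \<le> 1 * \<bar>W T\<bar> + K"
        using r \<open>0 < l0\<close> \<mu>(1)[of n] unfolding Z0
        by (intro add_right_mono mult_right_mono) (auto simp: less_imp_le)
      finally have 1: "\<bar>Z n (T - r)\<bar> \<le> \<bar>W T\<bar> + K"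
        by simp
      have "\<bar>Z n T\<bar> \<le> exp (- (l0 / \<mu> n * (T - (T - r)))) * \<bar>Z n (T - r)\<bar> + e / 2"
        using r d by (intro relax) (auto simp: dist_real_def less_imp_le)
      also have "\<dots> \<le> exp (- (l0 / \<mu> n * r)) * (\<bar>W T\<bar> + K) + e / 2"
        using 1 by simp
      finally show ?thesis
        by (simp add: ZT)
    qed
    \<comment> \<open>\<open>r\<close> depends on the path and on \<open>e\<close> but not on n, so
      the exponential factor vanishes as the mass does.\<close>
    have "filterlim \<mu> (at_right 0) sequentially"
      using \<mu> by (intro tendsto_imp_filterlim_at_right) auto
    then have "filterlim (\<lambda>n. inverse (\<mu> n)) at_top sequentially"
      by (rule filterlim_compose[OF filterlim_inverse_at_top_right])
    then have "filterlim (\<lambda>n. (l0 * r) * inverse (\<mu> n)) at_top sequentially"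
      using \<open>0 < l0\<close> r by (intro filterlim_tendsto_pos_mult_at_top[OF tendsto_const]) auto
    then have "filterlim (\<lambda>n. - ((l0 * r) * inverse (\<mu> n))) at_bot sequentially"
      by (simp add: filterlim_uminus_at_bot)
    then have "(\<lambda>n. exp (- ((l0 * r) * inverse (\<mu> n)))) \<longlonglongrightarrow> 0"
      by (rule filterlim_compose[OF exp_at_bot])
    then have "(\<lambda>n. exp (- (l0 / \<mu> n * r)) * (\<bar>W T\<bar> + K)) \<longlonglongrightarrow> 0"
      by (intro tendsto_mult_left_zero) (simp add: field_simps)
    then have "\<forall>\<^sub>F n in sequentially. exp (- (l0 / \<mu> n * r)) * (\<bar>W T\<bar> + K) < e / 2"
      using \<open>0 < e\<close> by (auto dest: order_tendstoD(2)[where a = "e / 2"])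
    then have "\<forall>\<^sub>F n in sequentially. norm (X n T - 0) < e"
    proof eventually_elim
      case (elim n)
      then show ?case
        using bound[of n] by simp
    qed
    then show "\<exists>N. \<forall>n\<ge>N. norm (X n T - 0) < e"
      by (simp add: eventually_sequentially)
  qed
qed

section \<open>Measurability, Wiener increments and normal moments\<close>

lemma continuous_adapted_measurable:
  assumes "filtered_prob_space M F" "continuous_adapted M F d X" "0 \<le> t" "i < d"
  shows "(\<lambda>\<omega>. X t \<omega> i) \<in> borel_measurable M"
  using assms unfolding filtered_prob_space_def continuous_adapted_def
  by (blast intro: measurable_from_subalg)

lemma continuous_adapted_path:
  assumes "continuous_adapted M F d X" "\<omega> \<in> space M" "i < d"
  shows "continuous_on {0..T} (\<lambda>t. X t \<omega> i)"
proof (rule continuous_on_subset)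
  show "continuous_on {0..} (\<lambda>t. X t \<omega> i)"
    using assms by (simp add: continuous_adapted_def)
qed auto

text \<open>Both facts pass from the increment vector to one coordinate: its law is a marginal of
  the product measure, and the sigma-algebra it generates lies inside that of the vector.\<close>

lemma
  assumes fps: "filtered_prob_space M F" and W: "wiener_process M F d W"
    and i: "i < d" and st: "0 \<le> s" "s < t"
  shows wiener_increment_distr:
      "distr M borel (\<lambda>\<omega>. W t \<omega> i - W s \<omega> i) = density lborel (normal_density 0 (sqrt (t - s)))"
    and wiener_increment_indep:
      "h \<in> borel_measurable (F s) \<Longrightarrow>
        prob_space.indep_var M borel h borel (\<lambda>\<omega>. W t \<omega> i - W s \<omega> i)"
proof -
  interpret prob_space M
    using fps by (simp add: filtered_prob_space_def)
  define D where "D = (\<lambda>\<omega>. \<lambda>i\<in>{..<d}. W t \<omega> i - W s \<omega> i)"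
  define N where "N = (\<Pi>\<^sub>M i\<in>{..<d}. (borel :: real measure))"
  have WM [measurable]: "(\<lambda>\<omega>. W t \<omega> j) \<in> borel_measurable M" "(\<lambda>\<omega>. W s \<omega> j) \<in> borel_measurable M"
    if "j < d" for j
    using continuous_adapted_measurable[OF fps _ _ that] W st by (auto simp: wiener_process_def)
  have D [measurable]: "D \<in> measurable M N"
    unfolding D_def N_def by (auto intro!: measurable_restrict)
  have indep: "indep_set (sets (F s)) (sets (vimage_algebra (space M) D N))"
    and distr: "distr M N D =
      (\<Pi>\<^sub>M i\<in>{..<d}. density lborel (\<lambda>x. ennreal (normal_density 0 (sqrt (t - s)) x)))"
    using W st unfolding wiener_process_def D_def N_def Let_def by blast+
  have comp [measurable]: "(\<lambda>x. x i) \<in> measurable N borel"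
    using i unfolding N_def by simp
  have eq: "(\<lambda>\<omega>. W t \<omega> i - W s \<omega> i) = (\<lambda>x. x i) \<circ> D"
    using i by (auto simp: D_def)
  have "distr M borel ((\<lambda>x. x i) \<circ> D) = distr (distr M N D) borel (\<lambda>x. x i)"
    by (rule distr_distr[symmetric]) measurable
  also have "\<dots> = distr (\<Pi>\<^sub>M i\<in>{..<d}. density lborel (normal_density 0 (sqrt (t - s))))
      (density lborel (normal_density 0 (sqrt (t - s)))) (\<lambda>x. x i)"
    unfolding distr by (rule distr_cong) auto
  also have "\<dots> = density lborel (normal_density 0 (sqrt (t - s)))"
    using i st by (intro distr_PiM_component prob_space_normal_density) auto
  finally show "distr M borel (\<lambda>\<omega>. W t \<omega> i - W s \<omega> i) =
      density lborel (normal_density 0 (sqrt (t - s)))"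
    by (simp add: eq)
  show "indep_var borel h borel (\<lambda>\<omega>. W t \<omega> i - W s \<omega> i)"
    if h: "h \<in> borel_measurable (F s)"
  proof -
    have sub: "subalgebra M (F s)"
      using fps by (simp add: filtered_prob_space_def)
    have sp: "space (F s) = space M"
      using sub by (simp add: subalgebra_def)
    have [measurable]: "h \<in> borel_measurable M"
      by (rule measurable_from_subalg[OF sub h])
    have 1: "sigma_sets (space (F s)) {h -` A \<inter> space (F s) |A. A \<in> sets borel} \<subseteq> sets (F s)"
      by (rule sets.sigma_sets_subset) (use measurable_sets[OF h] in auto)
    have "(\<lambda>\<omega>. W t \<omega> i - W s \<omega> i) \<in> borel_measurable (vimage_algebra (space M) D N)"
      unfolding eq by (rule measurable_comp[OF measurable_vimage_algebra1 comp])
        (rule Pi_I, rule measurable_space[OF D])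
    from measurable_sets[OF this]
    have 2: "{(\<lambda>\<omega>. W t \<omega> i - W s \<omega> i) -` A \<inter> space M |A. A \<in> sets borel}
        \<subseteq> sets (vimage_algebra (space M) D N)"
      by auto
    have 3: "sigma_sets (space M) {(\<lambda>\<omega>. W t \<omega> i - W s \<omega> i) -` A \<inter> space M |A. A \<in> sets borel}
        \<subseteq> sets (vimage_algebra (space M) D N)"
      using sets.sigma_sets_subset[OF 2] by simp
    have "indep_set (sigma_sets (space M) {h -` A \<inter> space M |A. A \<in> sets borel})
        (sigma_sets (space M) {(\<lambda>\<omega>. W t \<omega> i - W s \<omega> i) -` A \<inter> space M |A. A \<in> sets borel})"
      using indep 1[unfolded sp] 3 unfolding indep_sets2_eq by (meson subsetD subset_trans)
    with i show ?thesis
      unfolding indep_var_eq by (auto intro!: borel_measurable_diff WM)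
  qed
qed

text \<open>Needed because \<open>measure\<close> is \<open>0\<close> on nonmeasurable sets.\<close>

lemma superlevel_SUP_measurable:
  fixes f :: "real \<Rightarrow> 'w \<Rightarrow> real"
  assumes "a < b"
    and f: "\<And>t. t \<in> {a..b} \<Longrightarrow> f t \<in> borel_measurable M"
    and cont: "\<And>\<omega>. \<omega> \<in> space M \<Longrightarrow> continuous_on {a..b} (\<lambda>t. f t \<omega>)"
  shows "{\<omega>\<in>space M. c < (SUP t\<in>{a..b}. f t \<omega>)} \<in> sets M"
proof -
  have "c < (SUP t\<in>{a..b}. f t \<omega>) \<longleftrightarrow> (\<exists>t\<in>{a..b} \<inter> \<rat>. c < f t \<omega>)" if \<omega>: "\<omega> \<in> space M" for \<omega>
  proof -
    have "bdd_above ((\<lambda>t. f t \<omega>) ` {a..b})"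
      by (intro bounded_imp_bdd_above compact_imp_bounded compact_continuous_image cont \<omega>) auto
    then have "c < (SUP t\<in>{a..b}. f t \<omega>) \<longleftrightarrow> (\<exists>t\<in>{a..b}. c < f t \<omega>)"
      using \<open>a < b\<close> by (intro less_cSUP_iff) auto
    also have "\<dots> \<longleftrightarrow> (\<exists>t\<in>{a..b} \<inter> \<rat>. c < f t \<omega>)"
    proof
      assume "\<exists>t\<in>{a..b}. c < f t \<omega>"
      then obtain t where t: "t \<in> {a..b}" "c < f t \<omega>" by auto
      then obtain e where "e > 0" and
        e: "\<And>s. s \<in> {a..b} \<Longrightarrow> dist s t < e \<Longrightarrow> dist (f s \<omega>) (f t \<omega>) < f t \<omega> - c"
        using bspec[OF cont[OF \<omega>, unfolded continuous_on_iff] t(1), rule_format, of "f t \<omega> - c"] by auto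
      \<comment> \<open>The window around \<open>t\<close> is cut down to the interval so that
        \<open>t\<close> may be an endpoint; \<open>a < b\<close> keeps it nonempty.\<close>
      have "max a (t - e) < min b (t + e)"
        using t \<open>e > 0\<close> \<open>a < b\<close> by auto
      from Rats_dense_in_real[OF this] obtain r where "r \<in> \<rat>" "max a (t - e) < r" "r < min b (t + e)"
        by auto
      moreover from this have "\<bar>f r \<omega> - f t \<omega>\<bar> < f t \<omega> - c"
        using e[of r] by (auto simp: dist_real_def)
      ultimately show "\<exists>t\<in>{a..b} \<inter> \<rat>. c < f t \<omega>"
        by (intro bexI[of _ r]) auto
    qed auto
    finally show ?thesis .
  qed
  then have "{\<omega>\<in>space M. c < (SUP t\<in>{a..b}. f t \<omega>)} =
      (\<Union>t\<in>{a..b} \<inter> \<rat>. {\<omega>\<in>space M. c < f t \<omega>})"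
    by auto
  also have "\<dots> \<in> sets M"
  proof (rule sets.countable_UN')
    show "countable ({a..b} \<inter> \<rat>)"
      by (simp add: countable_rat)
  qed (use f in \<open>auto intro!: borel_measurable_less\<close>)
  finally show ?thesis .
qed

lemma
  fixes \<sigma> :: real
  assumes X: "X \<in> borel_measurable M" "distr M borel X = density lborel (normal_density 0 \<sigma>)"
    and \<sigma>: "0 < \<sigma>"
  shows integrable_centered_normal: "integrable M X"
    and integral_centered_normal: "(\<integral>\<omega>. X \<omega> \<partial>M) = 0"
    and integral_abs_centered_normal: "(\<integral>\<omega>. \<bar>X \<omega>\<bar> \<partial>M) = \<sigma> * sqrt (2 / pi)"
proof -
  have "integrable (distr M borel X) (\<lambda>x. x)"
    unfolding X(2) using integrable_normal_moment_nz_1[OF \<sigma>, of 0]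
    by (subst integrable_real_density) auto
  then show "integrable M X"
    by (subst (asm) integrable_distr_eq[OF X(1)]) auto
  have "(\<integral>\<omega>. X \<omega> \<partial>M) = integral\<^sup>L (distr M borel X) (\<lambda>x. x)"
    by (rule integral_distr[OF X(1), symmetric]) auto
  also have "\<dots> = 0"
    unfolding X(2) using integral_normal_moment_nz_1[OF \<sigma>, of 0]
    by (subst integral_real_density) auto
  finally show "(\<integral>\<omega>. X \<omega> \<partial>M) = 0" .
  have "(\<integral>\<omega>. \<bar>X \<omega>\<bar> \<partial>M) = integral\<^sup>L (distr M borel X) (\<lambda>x. \<bar>x\<bar>)"
    by (rule integral_distr[OF X(1), symmetric]) auto
  also have "\<dots> = \<sigma> * sqrt (2 / pi)"
    unfolding X(2) using integral_normal_moment_abs_odd[OF \<sigma>, of 0 0]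
    by (subst integral_real_density) auto
  finally show "(\<integral>\<omega>. \<bar>X \<omega>\<bar> \<partial>M) = \<sigma> * sqrt (2 / pi)" .
qed

section \<open>Ito integrals have mean zero\<close>

text \<open>Each height is known at the left end of its grid interval, hence independent of the
  centred increment that follows, and the mean of the product factorises.\<close>

lemma simple_ito_integral:
  assumes fps: "filtered_prob_space M F" and W: "wiener_process M F d W" and i: "i < d"
    and simple: "is_simple_process F t n u h"
  defines "S \<equiv> simple_integral_process (\<lambda>s \<omega>. W s \<omega> i) n u h"
  shows "integrable M S" "(\<integral>\<omega>. S \<omega> \<partial>M) = 0"
proof -
  interpret prob_space M
    using fps by (simp add: filtered_prob_space_def)
  have summand: "integrable M (\<lambda>\<omega>. h j \<omega> * (W (u (Suc j)) \<omega> i - W (u j) \<omega> i)) \<and>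
      (\<integral>\<omega>. h j \<omega> * (W (u (Suc j)) \<omega> i - W (u j) \<omega> i) \<partial>M) = 0" if "j < n" for j
  \<comment> \<open>Grid points may coincide, while the law of an increment is given only for
    \<open>s < t\<close>; a degenerate interval contributes 0.\<close>
  proof (cases "u j = u (Suc j)")
    case False
    have "0 \<le> u j" if "j \<le> n" for j
      using that simple
    proof (induction j)
      case (Suc j)
      then show ?case
        unfolding is_simple_process_def by (meson Suc_leD Suc_le_lessD order_trans)
    qed (auto simp: is_simple_process_def)
    then have u: "0 \<le> u j" "u j < u (Suc j)"
      using that simple False by (auto simp: is_simple_process_def less_le)
    have h: "h j \<in> borel_measurable (F (u j))" "bounded (h j ` space (F (u j)))"
      using simple that by (auto simp: is_simple_process_def)
    have sub: "subalgebra M (F (u j))"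
      using fps by (simp add: filtered_prob_space_def)
    have hM: "h j \<in> borel_measurable M"
      by (rule measurable_from_subalg[OF sub h(1)])
    obtain B where "\<And>\<omega>. \<omega> \<in> space M \<Longrightarrow> \<bar>h j \<omega>\<bar> \<le> B"
      using h(2) sub by (auto simp: bounded_iff subalgebra_def)
    then have inth: "integrable M (h j)"
      using hM by (intro integrable_const_bound[of _ B]) auto
    have "continuous_adapted M F d W"
      using W by (simp add: wiener_process_def)
    then have WM: "(\<lambda>\<omega>. W (u (Suc j)) \<omega> i - W (u j) \<omega> i) \<in> borel_measurable M"
      using u i by (intro borel_measurable_diff continuous_adapted_measurable[OF fps]) auto
    note normal = WM wiener_increment_distr[OF fps W i u]
    have \<sigma>: "0 < sqrt (u (Suc j) - u j)"
      using u by simp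
    note ind = wiener_increment_indep[OF fps W i u h(1)]
    show ?thesis
      using indep_var_integrable[OF ind inth integrable_centered_normal[OF normal \<sigma>]]
        indep_var_lebesgue_integral[OF ind inth integrable_centered_normal[OF normal \<sigma>]]
      by (simp add: integral_centered_normal[OF normal \<sigma>])
  qed auto
  from summand show "integrable M S" "(\<integral>\<omega>. S \<omega> \<partial>M) = 0"
    unfolding S_def simple_integral_process_def by (auto simp: Bochner_Integration.integral_sum)
qed

text \<open>On a probability space L^2 convergence implies convergence of means, so the zero mean of
  the simple integrals passes to the limit.\<close>

lemma
  assumes fps: "filtered_prob_space M F" and W: "wiener_process M F d W" and i: "i < d"
    and ito: "has_ito_integral M F (\<lambda>s \<omega>. W s \<omega> i) t H I"
  shows ito_integral_integrable: "integrable M I"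
    and ito_integral_expectation: "(\<integral>\<omega>. I \<omega> \<partial>M) = 0"
proof -
  interpret prob_space M
    using fps by (simp add: filtered_prob_space_def)
  from ito obtain n u h where simple: "\<And>k. is_simple_process F t (n k) (u k) (h k)"
    and lim: "(\<lambda>k. \<integral>\<^sup>+\<omega>. ennreal ((I \<omega> - simple_integral_process (\<lambda>s \<omega>. W s \<omega> i) (n k) (u k) (h k) \<omega>)\<^sup>2) \<partial>M)
          \<longlonglongrightarrow> 0"
    and I [measurable]: "I \<in> borel_measurable M"
    unfolding has_ito_integral_def by blast
  define S where "S k = simple_integral_process (\<lambda>s \<omega>. W s \<omega> i) (n k) (u k) (h k)" for k
  note S = simple_ito_integral[OF fps W i simple, folded S_def]
  have [measurable]: "S k \<in> borel_measurable M" for k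
    using S(1)[of k] by auto
  have bound: "integrable M I \<and> \<bar>\<integral>\<omega>. I \<omega> \<partial>M\<bar> \<le> e" if "0 < e" for e :: real
  proof -
    have "\<forall>\<^sub>F k in sequentially. (\<integral>\<^sup>+\<omega>. ennreal ((I \<omega> - S k \<omega>)\<^sup>2) \<partial>M) < ennreal (e\<^sup>2)"
      using order_tendstoD(2)[OF lim[folded S_def], of "ennreal (e\<^sup>2)"] that by simp
    then obtain k where k: "(\<integral>\<^sup>+\<omega>. ennreal ((I \<omega> - S k \<omega>)\<^sup>2) \<partial>M) < ennreal (e\<^sup>2)"
      by (auto simp: eventually_sequentially)
    have sq: "integrable M (\<lambda>\<omega>. (I \<omega> - S k \<omega>)\<^sup>2)"
      using k by (intro integrableI_bounded) (auto simp: order.strict_trans)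
    have "(\<integral>\<omega>. (I \<omega> - S k \<omega>)\<^sup>2 \<partial>M) < e\<^sup>2"
      using k nn_integral_eq_integral[OF sq] that by (simp add: ennreal_less_iff)
    moreover have diff: "integrable M (\<lambda>\<omega>. I \<omega> - S k \<omega>)"
      by (rule square_integrable_imp_integrable[OF _ sq]) measurable
    \<comment> \<open>The square of the mean is at most the second moment because the variance is
      nonnegative.\<close>
    then have "(\<integral>\<omega>. I \<omega> - S k \<omega> \<partial>M)\<^sup>2 \<le> (\<integral>\<omega>. (I \<omega> - S k \<omega>)\<^sup>2 \<partial>M)"
      using variance_eq[OF diff sq] variance_positive[of "\<lambda>\<omega>. I \<omega> - S k \<omega>"] by simp
    ultimately have "\<bar>\<integral>\<omega>. I \<omega> - S k \<omega> \<partial>M\<bar> \<le> \<bar>e\<bar>"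
      unfolding abs_le_square_iff by linarith
    moreover have "integrable M (\<lambda>\<omega>. (I \<omega> - S k \<omega>) + S k \<omega>)"
      by (intro Bochner_Integration.integrable_add diff S)
    ultimately show ?thesis
      using S diff that by simp
  qed
  show "integrable M I"
    using bound[of 1] by simp
  show "(\<integral>\<omega>. I \<omega> \<partial>M) = 0"
    using bound dense_ge[of 0 "\<bar>\<integral>\<omega>. I \<omega> \<partial>M\<bar>"] by force
qed


section \<open>The friction and its primitive\<close>

text \<open>Carries one-variable calculus over to sequences: in dimension one only index 0 matters,
  and \<open>x(0 := s)\<close> has entry \<open>s\<close> there. It serves both the friction and the
  zero field.\<close>

lemma C1_bounded_coordinate:
  fixes f :: "real \<Rightarrow> real"
  assumes f': "\<And>x. (f has_real_derivative f' x) (at x)" and "continuous_on UNIV f'"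
    and "bounded (range f)" "bounded (range f')"
  shows "C1_bounded 1 (\<lambda>x. f (x 0))"
proof -
  have cont: "continuous_map (Euclidean_space 1) euclideanreal (\<lambda>x. g (x 0))"
    if "continuous_on UNIV g" for g :: "real \<Rightarrow> real"
    unfolding continuous_map_Euclidean_space_iff
    by (rule continuous_on_compose2[OF that])
      (auto intro: continuous_on_subset[OF continuous_on_product_coordinates])
  have "continuous_on UNIV f"
    by (rule DERIV_continuous_on) (rule DERIV_subset[OF f'], simp)
  moreover have "bounded ((\<lambda>x. g (x 0)) ` topspace (Euclidean_space 1))" if "bounded (range g)"
    for g :: "real \<Rightarrow> real"
    using that by (rule bounded_subset) auto
  ultimately show ?thesis
    unfolding C1_bounded_def using assms cont[of f] cont[of f']
    by (auto intro!: exI[of _ "\<lambda>_ x. f' (x 0)"])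
qed

text \<open>The quotient is the derivative of \<open>sqrt (1 + x\<^sup>2)\<close>, so the primitive
  is elementary, and it falls short of the linear \<open>2 * x\<close> by at least
  \<open>\<bar>x\<bar>\<close>. The constant 2 keeps the friction above 1.\<close>

definition friction :: "real \<Rightarrow> real" where
  "friction x = 2 - x / sqrt (1 + x\<^sup>2)"

definition friction_potential :: "real \<Rightarrow> real" where
  "friction_potential x = 2 * x - sqrt (1 + x\<^sup>2)"

lemma one_plus_square_pos: "0 < 1 + (x::real)\<^sup>2"
  by (simp add: add_pos_nonneg)

lemma friction_bounds: "1 \<le> friction x" "friction x \<le> 3"
proof -
  have "\<bar>x\<bar> \<le> sqrt (1 + x\<^sup>2)"
    by (rule real_le_rsqrt) simp
  then have "x / sqrt (1 + x\<^sup>2) \<le> 1" "- 1 \<le> x / sqrt (1 + x\<^sup>2)"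
    using one_plus_square_pos[of x] by (auto simp: divide_le_eq le_divide_eq)
  then show "1 \<le> friction x" "friction x \<le> 3"
    by (auto simp: friction_def)
qed

lemma friction_deriv:
  "(friction has_real_derivative - (1 / ((1 + x\<^sup>2) * sqrt (1 + x\<^sup>2)))) (at x)"
proof -
  define r where "r = sqrt (1 + x\<^sup>2)"
  have r: "0 < r" "r\<^sup>2 = 1 + x\<^sup>2" "1 + x\<^sup>2 \<noteq> 0"
    using one_plus_square_pos[of x] by (auto simp: r_def)
  have "((\<lambda>x. sqrt (1 + x\<^sup>2)) has_real_derivative x / r) (at x)"
    unfolding r_def using one_plus_square_pos[of x]
    by (auto intro!: derivative_eq_intros simp: field_simps)
  from DERIV_diff[OF DERIV_const[of 2] DERIV_divide[OF DERIV_ident this]]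
  have "((\<lambda>x. 2 - x / sqrt (1 + x\<^sup>2)) has_real_derivative - ((1 * r - x * (x / r)) / (r * r))) (at x)"
    using r(1) unfolding r_def[symmetric] by simp
  moreover have "(1 * r - x * (x / r)) / (r * r) = 1 / (r\<^sup>2 * r)"
    using r by (simp add: field_simps power2_eq_square)
  ultimately show ?thesis
    by (simp add: friction_def[abs_def] r(2)) (simp add: r_def)
qed

lemma C1_bounded_friction: "C1_bounded 1 (\<lambda>x. friction (x 0))"
proof (rule C1_bounded_coordinate[OF friction_deriv])
  show "continuous_on UNIV (\<lambda>x::real. - (1 / ((1 + x\<^sup>2) * sqrt (1 + x\<^sup>2))))"
    using one_plus_square_pos by (intro continuous_intros) (auto simp: less_imp_neq[symmetric])
  show "bounded (range friction)"
    unfolding bounded_iff using friction_bounds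
    by (intro exI[of _ 3]) (auto simp: abs_le_iff intro: order_trans[of _ "- 1"])
  have "1 \<le> (1 + x\<^sup>2) * sqrt (1 + x\<^sup>2)" for x :: real
    using mult_mono[of 1 "1 + x\<^sup>2" 1 "sqrt (1 + x\<^sup>2)"] by simp
  then show "bounded (range (\<lambda>x::real. - (1 / ((1 + x\<^sup>2) * sqrt (1 + x\<^sup>2)))))"
    unfolding bounded_iff by (intro exI[of _ 1]) (force simp: divide_le_eq)
qed

lemma friction_potential_deriv: "(friction_potential has_real_derivative friction x) (at x)"
  unfolding friction_potential_def[abs_def] friction_def using one_plus_square_pos[of x]
  by (auto intro!: derivative_eq_intros simp: field_simps)

lemma friction_potential_lipschitz:
  "\<bar>friction_potential x - friction_potential y\<bar> \<le> 3 * \<bar>x - y\<bar>"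
proof -
  have "norm (friction_potential x - friction_potential y) \<le> 3 * norm (x - y)"
    by (rule field_differentiable_bound[of UNIV])
      (use friction_potential_deriv friction_bounds in
        \<open>auto simp: abs_le_iff intro: order_trans[of _ "- 1"]\<close>)
  then show ?thesis
    by simp
qed

section \<open>The small-mass limit and convergence in probability\<close>

text \<open>The position paths are C^1 for positive mass, so the ordinary chain rule applies to
  \<open>V\<close> and no second-order Ito term appears. The limit keeps this form, whereas the Ito
  solution does not obey the ordinary chain rule.\<close>

lemma small_mass_potential_limit:
  fixes V v :: "real \<Rightarrow> real"
  assumes V: "\<And>x. (V has_real_derivative v x) (at x)" "continuous_on UNIV v"
    and v: "\<And>x. v0 \<le> v x" "0 < v0"
    and \<mu>: "\<And>n. 0 < \<mu> n" "\<mu> \<longlonglongrightarrow> 0"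
    and W: "continuous_adapted M F 1 W" and "0 < T"
    and sol: "\<And>n. langevin_solution M F 1 W (\<lambda>_ _. 0) (\<lambda>x. v (x 0)) (\<mu> n) (\<lambda>_. q) (\<lambda>_. 0) (Q n) (P n)"
  shows "AE \<omega> in M. (\<lambda>n. V (Q n T \<omega> 0)) \<longlonglongrightarrow> V q + W T \<omega> 0"
proof -
  \<comment> \<open>Countably many masses allow a single exceptional null set for all of
    them.\<close>
  have "AE \<omega> in M. \<forall>n. \<forall>t\<ge>0.
      Q n t \<omega> 0 = q + integral {0..t} (\<lambda>s. P n s \<omega> 0) \<and>
      P n t \<omega> 0 = integral {0..t} (\<lambda>s. - (v (Q n s \<omega> 0) / \<mu> n * P n s \<omega> 0)) + W t \<omega> 0 / \<mu> n"
    using sol unfolding AE_all_countable langevin_solution_def by simp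
  then show ?thesis
    using AE_space
  proof eventually_elim
    case (elim \<omega>)
    define Qn where "Qn n t = Q n t \<omega> 0" for n t
    define Pn where "Pn n t = P n t \<omega> 0" for n t
    define X where "X n t = \<mu> n * Pn n t" for n t
    have W_cont: "continuous_on {0..T} (\<lambda>t. W t \<omega> 0)"
      using elim(2) by (intro continuous_adapted_path[OF W]) auto
    have cont: "continuous_on {0..T} (Qn n)" "continuous_on {0..T} (Pn n)" for n
      using sol[of n] elim(2) unfolding langevin_solution_def Qn_def[abs_def] Pn_def[abs_def]
      by (auto intro!: continuous_adapted_path)
    have cont_v: "continuous_on {0..T} (\<lambda>t. v (Qn n t))" for n
      by (rule continuous_on_compose2[OF V(2) cont(1)]) auto
    have Q: "Qn n t = q + integral {0..t} (Pn n)" if "0 \<le> t" for n t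
      using elim(1) that by (simp add: Qn_def Pn_def[abs_def])
    have X: "X n t = W t \<omega> 0 - integral {0..t} (\<lambda>s. v (Qn n s) / \<mu> n * X n s)" if "0 \<le> t" for n t
    proof -
      have "Pn n t = integral {0..t} (\<lambda>s. - (v (Qn n s) / \<mu> n * Pn n s)) + W t \<omega> 0 / \<mu> n"
        using elim(1) that by (simp add: Qn_def Pn_def)
      then have "X n t = W t \<omega> 0 - \<mu> n * integral {0..t} (\<lambda>s. v (Qn n s) / \<mu> n * Pn n s)"
        using \<mu>(1)[of n] unfolding X_def by (simp add: field_simps)
      also have "\<mu> n * integral {0..t} (\<lambda>s. v (Qn n s) / \<mu> n * Pn n s) =
          integral {0..t} (\<lambda>s. v (Qn n s) / \<mu> n * X n s)"
        unfolding X_def integral_mult_right[symmetric] by (simp add: mult_ac)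
      finally show ?thesis .
    qed
    have "(\<lambda>n. X n T) \<longlonglongrightarrow> 0"
    proof (rule friction_kills_momentum[OF \<open>0 < T\<close> v(2) W_cont \<mu>, where l = "\<lambda>n t. v (Qn n t)"])
      show "continuous_on {0..T} (X n)" for n
        unfolding X_def[abs_def] by (intro continuous_intros cont)
    qed (use X v cont_v in auto)
    moreover have "V (Qn n T) = V q + W T \<omega> 0 - X n T" for n
    proof -
      have Q': "(Qn n has_real_derivative Pn n t) (at t within {0..T})" if t: "t \<in> {0..T}" for t
      proof -
        have "((\<lambda>t. q + integral {0..t} (Pn n)) has_real_derivative 0 + Pn n t) (at t within {0..T})"
          by (intro DERIV_add DERIV_const integral_has_real_derivative cont t)
        then show ?thesis
          using t Q by (subst has_field_derivative_cong_eventually[where g = "\<lambda>t. q + integral {0..t} (Pn n)"])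
            (auto simp: eventually_at_filter)
      qed
      \<comment> \<open>The friction term of the momentum equation is the exact derivative of
        \<open>V\<close> along the trajectory.\<close>
      have "((\<lambda>s. v (Qn n s) * Pn n s) has_integral V (Qn n T) - V (Qn n 0)) {0..T}"
        using \<open>0 < T\<close> DERIV_chain2[OF V(1) Q']
        by (intro fundamental_theorem_of_calculus)
          (auto simp: has_real_derivative_iff_has_vector_derivative[symmetric])
      then have "integral {0..T} (\<lambda>s. v (Qn n s) * Pn n s) = V (Qn n T) - V q"
        using Q[of 0] by (simp add: integral_unique)
      moreover have "(\<lambda>s. v (Qn n s) / \<mu> n * X n s) = (\<lambda>s. v (Qn n s) * Pn n s)"
        using \<mu>(1)[of n] by (auto simp: X_def)
      ultimately show ?thesis
        using X[of T n] \<open>0 < T\<close> by simp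
    qed
    ultimately show ?case
      using tendsto_diff[OF tendsto_const[of "V q + W T \<omega> 0"], of "\<lambda>n. X n T" 0]
      by (simp add: Qn_def)
  qed
qed

text \<open>Staying in all \<open>A n\<close> from some m on has probability at most every later
  \<open>prob (A n)\<close>, hence 0. This weak consequence of convergence in probability suffices
  when combined with an almost sure limit along the whole sequence.\<close>

lemma (in prob_space) AE_frequently_not_in:
  assumes "\<And>n. A n \<in> events" "(\<lambda>n. prob (A n)) \<longlonglongrightarrow> 0"
  shows "AE \<omega> in M. \<exists>\<^sub>F n in sequentially. \<omega> \<notin> A n"
proof -
  have "AE \<omega> in M. \<not> (\<forall>n\<ge>m. \<omega> \<in> A n)" for m
  proof -
    have "prob (\<Inter>n\<in>{m..}. A n) \<le> 0"
    proof (rule LIMSEQ_le_const[OF assms(2)], intro exI allI impI)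
      show "prob (\<Inter>n\<in>{m..}. A n) \<le> prob (A n)" if "m \<le> n" for n
        using assms(1) that by (intro finite_measure_mono) auto
    qed
    then have "emeasure M (\<Inter>n\<in>{m..}. A n) = 0"
      by (simp add: emeasure_eq_measure measure_le_0_iff)
    then have "(\<Inter>n\<in>{m..}. A n) \<in> null_sets M"
      using assms(1) by (auto intro!: sets.countable_INT')
    from AE_not_in[OF this] show ?thesis
      by eventually_elim auto
  qed
  then have "AE \<omega> in M. \<forall>m. \<not> (\<forall>n\<ge>m. \<omega> \<in> A n)"
    unfolding AE_all_countable by blast
  then show ?thesis
    by eventually_elim (auto simp: frequently_sequentially)
qed

section \<open>The counterexample\<close>

theorem mainTheorem1:
  "\<exists>(d::nat) (b :: (nat \<Rightarrow> real) \<Rightarrow> nat \<Rightarrow> real) (lam :: (nat \<Rightarrow> real) \<Rightarrow> real)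
      (q :: nat \<Rightarrow> real) (p :: nat \<Rightarrow> real) (\<kappa>::real) (T::real).
     d \<ge> 1 \<and>
     C1_bounded_field d b \<and> C1_bounded d lam \<and>
     (\<exists>lam0 Lam. 0 < lam0 \<and> (\<forall>x\<in>topspace (Euclidean_space d). lam0 \<le> lam x \<and> lam x \<le> Lam)) \<and>
     q \<in> topspace (Euclidean_space d) \<and> p \<in> topspace (Euclidean_space d) \<and>
     \<kappa> > 0 \<and> T > 0 \<and>
     (\<forall>(M :: 'w measure) F W Q\<mu> P\<mu> Q.
        filtered_prob_space M F \<longrightarrow>
        wiener_process M F d W \<longrightarrow>
        (\<forall>\<mu>>0. langevin_solution M F d W b lam \<mu> q p (Q\<mu> \<mu>) (P\<mu> \<mu>)) \<longrightarrow>
        ito_sde_solution M F d W (\<lambda>x i. b x i / lam x) (\<lambda>x. 1 / lam x) q Q \<longrightarrow>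
        \<not> ((\<lambda>\<mu>. measure M {\<omega>\<in>space M.
               (SUP t\<in>{0..T}. L2_set (\<lambda>i. Q\<mu> \<mu> t \<omega> i - Q t \<omega> i) {..<d}) > \<kappa>})
             \<longlongrightarrow> 0) (at_right 0))"
\<comment> \<open>With \<open>\<kappa> = 1/5\<close> the Lipschitz constant 3 gives an error 3/5.
  Time 100 gives the Wiener process standard deviation 10, hence mean absolute value
  \<open>10 * sqrt (2 / pi)\<close>, at least 6, against the bound 27/5 derived below.\<close>
proof (rule exI[of _ 1], rule exI[of _ "\<lambda>_ _. 0"], rule exI[of _ "\<lambda>x. friction (x 0)"],
    rule exI[of _ "\<lambda>_. 0"], rule exI[of _ "\<lambda>_. 0"], rule exI[of _ "1/5"], rule exI[of _ 100],
    intro conjI allI impI notI)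
  fix M :: "'w measure" and F W Q\<mu> P\<mu> Q
  assume fps: "filtered_prob_space M F" and W: "wiener_process M F 1 W"
    and lang: "\<forall>\<mu>>0. langevin_solution M F 1 W (\<lambda>_ _. 0) (\<lambda>x. friction (x 0)) \<mu> (\<lambda>_. 0) (\<lambda>_. 0) (Q\<mu> \<mu>) (P\<mu> \<mu>)"
    and ito: "ito_sde_solution M F 1 W (\<lambda>x i. 0 / friction (x 0)) (\<lambda>x. 1 / friction (x 0)) (\<lambda>_. 0) Q"
    and conv: "((\<lambda>\<mu>. measure M {\<omega>\<in>space M.
               1/5 < (SUP t\<in>{0..100}. L2_set (\<lambda>i. Q\<mu> \<mu> t \<omega> i - Q t \<omega> i) {..<1})})
             \<longlongrightarrow> 0) (at_right 0)"
  interpret prob_space M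
    using fps by (simp add: filtered_prob_space_def)
  define \<mu> :: "nat \<Rightarrow> real" where "\<mu> n = inverse (real (Suc n))" for n
  have \<mu>: "0 < \<mu> n" "\<mu> \<longlonglongrightarrow> 0" for n
    using LIMSEQ_inverse_real_of_nat by (auto simp: \<mu>_def[abs_def])
  have \<mu>_right: "filterlim \<mu> (at_right 0) sequentially"
    using \<mu> by (intro tendsto_imp_filterlim_at_right) auto
  have WA: "continuous_adapted M F 1 W" and QA: "continuous_adapted M F 1 Q"
    and Q\<mu>A: "continuous_adapted M F 1 (Q\<mu> (\<mu> n))" for n
    using W ito lang \<mu> by (auto simp: wiener_process_def ito_sde_solution_def langevin_solution_def)
  define w where "w \<omega> = W 100 \<omega> 0 - W 0 \<omega> 0" for \<omega>
  define x where "x \<omega> = Q 100 \<omega> 0" for \<omega>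
  have limit: "AE \<omega> in M. (\<lambda>n. friction_potential (Q\<mu> (\<mu> n) 100 \<omega> 0)) \<longlonglongrightarrow>
      friction_potential 0 + W 100 \<omega> 0"
    by (rule small_mass_potential_limit[OF friction_potential_deriv _ friction_bounds(1) _ \<mu> WA])
      (use lang \<mu> in \<open>auto intro: DERIV_continuous_on DERIV_subset[OF friction_deriv]\<close>)
  define A where "A n = {\<omega>\<in>space M. 1/5 < (SUP t\<in>{0..100}. \<bar>Q\<mu> (\<mu> n) t \<omega> 0 - Q t \<omega> 0\<bar>)}" for n
  have cont: "continuous_on {0..100} (\<lambda>t. \<bar>Q\<mu> (\<mu> n) t \<omega> 0 - Q t \<omega> 0\<bar>)" if "\<omega> \<in> space M" for n \<omega>
    by (intro continuous_intros continuous_adapted_path[OF QA] continuous_adapted_path[OF Q\<mu>A] that) auto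
  have A: "A n \<in> events" for n
    unfolding A_def
    by (rule superlevel_SUP_measurable)
      (auto intro!: cont borel_measurable_abs borel_measurable_diff continuous_adapted_measurable[OF fps] QA Q\<mu>A)
  have "(\<lambda>n. prob (A n)) \<longlonglongrightarrow> 0"
    using filterlim_compose[OF conv \<mu>_right] by (simp add: A_def L2_set_def lessThan_Suc)
  from AE_frequently_not_in[OF A this] limit
  have "AE \<omega> in M. \<bar>friction_potential (x \<omega>) - (friction_potential 0 + W 100 \<omega> 0)\<bar> \<le> 3/5"
    using AE_space
  proof eventually_elim
    case (elim \<omega>)
    have near: "\<bar>friction_potential (Q\<mu> (\<mu> n) 100 \<omega> 0) - friction_potential (x \<omega>)\<bar> \<le> 3/5"
      if "\<omega> \<notin> A n" for n
    proof -
      have "bdd_above ((\<lambda>t. \<bar>Q\<mu> (\<mu> n) t \<omega> 0 - Q t \<omega> 0\<bar>) ` {0..100})"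
        by (intro bounded_imp_bdd_above compact_imp_bounded compact_continuous_image cont elim) auto
      then have "\<bar>Q\<mu> (\<mu> n) 100 \<omega> 0 - Q 100 \<omega> 0\<bar> \<le> (SUP t\<in>{0..100}. \<bar>Q\<mu> (\<mu> n) t \<omega> 0 - Q t \<omega> 0\<bar>)"
        by (intro cSUP_upper) auto
      then show ?thesis
        using that elim(3) friction_potential_lipschitz[of "Q\<mu> (\<mu> n) 100 \<omega> 0" "x \<omega>"]
        by (simp add: A_def x_def not_less)
    qed
    \<comment> \<open>If the limiting distance exceeded 3/5, the path would eventually lie in every
      \<open>A n\<close>, although it avoids infinitely many of them.\<close>
    show ?case
    proof (rule ccontr)
      assume "\<not> ?thesis"
      then have "3/5 < \<bar>friction_potential 0 + W 100 \<omega> 0 - friction_potential (x \<omega>)\<bar>"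
        by (subst abs_minus_commute) simp
      moreover have "(\<lambda>n. \<bar>friction_potential (Q\<mu> (\<mu> n) 100 \<omega> 0) - friction_potential (x \<omega>)\<bar>) \<longlonglongrightarrow>
          \<bar>friction_potential 0 + W 100 \<omega> 0 - friction_potential (x \<omega>)\<bar>"
        by (intro tendsto_intros elim)
      ultimately have "\<forall>\<^sub>F n in sequentially.
          3/5 < \<bar>friction_potential (Q\<mu> (\<mu> n) 100 \<omega> 0) - friction_potential (x \<omega>)\<bar>"
        by (rule order_tendstoD(1)[rotated])
      then have "\<forall>\<^sub>F n in sequentially. \<omega> \<in> A n"
        by eventually_elim (use near in force)
      with elim(1) show False
        by (simp add: frequently_def)
    qed
  qed
  moreover have "AE \<omega> in M. W 0 \<omega> 0 = 0"
    using W by (simp add: wiener_process_def)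
  ultimately have close: "AE \<omega> in M. \<bar>friction_potential (x \<omega>) - (friction_potential 0 + w \<omega>)\<bar> \<le> 3/5"
    by eventually_elim (simp add: w_def)
  \<comment> \<open>\<open>close\<close> bounds \<open>w\<close> plus the square root by
    \<open>2 * x\<close> plus 8/5. By the Lipschitz bound the square root, being at least
    \<open>\<bar>x\<bar>\<close>, is at least \<open>\<bar>w\<bar> / 3\<close> minus 1/5.\<close>
  have ineq: "AE \<omega> in M. w \<omega> + \<bar>w \<omega>\<bar> / 3 \<le> 2 * x \<omega> + 9/5"
    using close
  proof eventually_elim
    case (elim \<omega>)
    have "\<bar>w \<omega>\<bar> \<le> 3 * \<bar>x \<omega>\<bar> + 3/5"
      using elim friction_potential_lipschitz[of "x \<omega>" 0] unfolding diff_zero by linarith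
    moreover have "\<bar>x \<omega>\<bar> \<le> sqrt (1 + (x \<omega>)\<^sup>2)"
      by (rule real_le_rsqrt) simp
    moreover have "friction_potential 0 = - 1"
      by (simp add: friction_potential_def)
    ultimately show ?case
      using elim unfolding friction_potential_def[of "x \<omega>"] by linarith
  qed
  have w_meas: "w \<in> borel_measurable M"
    unfolding w_def[abs_def] by (intro borel_measurable_diff continuous_adapted_measurable[OF fps WA]) auto
  have w_distr: "distr M borel w = density lborel (normal_density 0 10)"
    using wiener_increment_distr[OF fps W, of 0 0 100] by (simp add: w_def[abs_def])
  have w_int: "integrable M w"
    by (rule integrable_centered_normal[OF w_meas w_distr]) simp
  \<comment> \<open>With zero drift and zero start the Ito solution is itself a stochastic
    integral.\<close>
  have x_ito: "has_ito_integral M F (\<lambda>s \<omega>. W s \<omega> 0) 100 (\<lambda>s \<omega>. 1 / friction (Q s \<omega> 0)) x"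
    using ito by (simp add: ito_sde_solution_def x_def[abs_def])
  have x_int: "integrable M x"
    by (rule ito_integral_integrable[OF fps W _ x_ito]) simp
  have x_exp: "(\<integral>\<omega>. x \<omega> \<partial>M) = 0"
    by (rule ito_integral_expectation[OF fps W _ x_ito]) simp
  \<comment> \<open>The linear terms have mean zero, leaving a third of the mean of
    \<open>\<bar>w\<bar>\<close> below 9/5.\<close>
  have "(\<integral>\<omega>. w \<omega> + \<bar>w \<omega>\<bar> / 3 \<partial>M) \<le> (\<integral>\<omega>. 2 * x \<omega> + 9/5 \<partial>M)"
    by (intro integral_mono_AE ineq) (simp_all add: w_int x_int)
  then have "10 * sqrt (2 / pi) \<le> 27/5"
    using w_int x_int x_exp integral_centered_normal[OF w_meas w_distr]
      integral_abs_centered_normal[OF w_meas w_distr] prob_space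
    by simp
  moreover have "6/10 \<le> sqrt (2 / pi)"
    using pi_less_4 by (intro real_le_rsqrt) (simp add: field_simps power2_eq_square)
  ultimately show False
    by simp
next
  have "C1_bounded 1 (\<lambda>x. (\<lambda>_. 0) (x 0))"
    by (rule C1_bounded_coordinate[where f' = "\<lambda>_. 0"]) (auto simp: image_constant_conv)
  then show "C1_bounded_field 1 (\<lambda>_ _. 0)"
    by (simp add: C1_bounded_field_def topspace_Euclidean_space)
  show "\<exists>lam0 Lam. 0 < lam0 \<and>
      (\<forall>x\<in>topspace (Euclidean_space 1). lam0 \<le> friction (x 0) \<and> friction (x 0) \<le> Lam)"
    using friction_bounds zero_less_one by blast
qed (rule C1_bounded_friction | simp add: topspace_Euclidean_space)+

end
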